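(* There exist an instance $P$ and learned parameter vectors $\mathbf{w},\mathbf{w}^*$, where $\mathbf{w}$ is $\tau$-approximate with respect to $\mathbf{w}^*$, such that using proportional allocation with $\mathbf{w}^*$ obtains a MaxMin objective of $\Omega(\tau)$, while even when $\mathbf{w}$ is known offline, any online algorithm achieves a MaxMin objective of $O(1)$.
   Context: There are $n$ divisible items that arrive online and $m$ agents. An instance is a matrix $P=(p_{i,j})\in\mathbb{R}_{>0}^{m\times n}$, where $p_{i,j}$ is the weight (utility) of item $j$ for agent $i$, revealed when item $j$ arrives (a weight $0$ may be replaced by an arbitrarily small positive weight). An allocation is $x_{i,j}\in[0,1]$ with $\sum_i x_{i,j}=1$ for every $j$; the load of agent $i$ is $\sum_j p_{i,j}x_{i,j}$. The MaxMin (Santa Claus) objective, to be maximized, is the minimum load over all agents. An online algorithm must fix the allocation of each item when it arrives; information "known offline" is available to it in advance. Learned parameter vectors are elements of $\mathbb{R}_{>0}^m$. Proportional allocation with parameter vector $\mathbf{w}$ sets $x_{i,j}=\dfrac{p_{i,j}^{\alpha}w_i}{\sum_{i'}p_{i',j}^{\alpha}w_{i'}}$, where $\alpha$ is a fixed exponent depending only on the objective (a large positive number for MaxMin). $\mathbf{w}$ is $\tau$-approximate with respect to $\mathbf{w}^*$ if $\frac{w_{i'}}{w_i}\le\tau\cdot\frac{w^*_{i'}}{w^*_i}$ for any two agents $i,i'$. Here $\tau\ge 1$ is the error parameter, and $\Omega(\cdot)$, $O(\cdot)$ are asymptotic in $\tau$. *)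

theory Defs
  imports Complex_Main "Jordan_Normal_Form.Matrix"
begin

definition pos_vecs :: "nat \<Rightarrow> real vec set" where
  "pos_vecs m = {v \<in> carrier_vec m. \<forall>i<m. 0 < v $ i}"

text \<open>Rows are agents, columns are items, in order of arrival.\<close>

definition instances :: "nat \<Rightarrow> nat \<Rightarrow> real mat set" where
  "instances m n = {P \<in> carrier_mat m n. \<forall>i<m. \<forall>j<n. 0 < P $$ (i, j)}"

definition load :: "real mat \<Rightarrow> real mat \<Rightarrow> nat \<Rightarrow> real" where
  "load P x i = (\<Sum>j<dim_col P. P $$ (i, j) * x $$ (i, j))"

definition maxmin :: "real mat \<Rightarrow> real mat \<Rightarrow> real" where
  "maxmin P x = Min (load P x ` {..<dim_row P})"

definition prop_alloc :: "real \<Rightarrow> real mat \<Rightarrow> real vec \<Rightarrow> real mat" where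
  "prop_alloc \<alpha> P w = mat (dim_row P) (dim_col P)
     (\<lambda>(i, j). (P $$ (i, j) powr \<alpha> * w $ i) /
               (\<Sum>i'<dim_row P. P $$ (i', j) powr \<alpha> * w $ i'))"

definition approximate_wrt :: "nat \<Rightarrow> real \<Rightarrow> real vec \<Rightarrow> real vec \<Rightarrow> bool" where
  "approximate_wrt m \<tau> w w' \<longleftrightarrow>
     (\<forall>i<m. \<forall>i'<m. w $ i' / w $ i \<le> \<tau> * (w' $ i' / w' $ i))"

definition item_allocations :: "nat \<Rightarrow> real vec set" where
  "item_allocations m =
     {y \<in> carrier_vec m. (\<forall>i<m. y $ i \<in> {0..1}) \<and> (\<Sum>i<m. y $ i) = 1}"

text \<open>An online algorithm sees the parameter vector \<open>w\<close> from the start.  \<open>A w cs\<close> is its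
  (irrevocable) allocation of the last item in the nonempty list \<open>cs\<close> of the weight columns
  that have been revealed so far.  It need not be given its own earlier decisions, as they are
  determined by \<open>w\<close> and the prefixes of \<open>cs\<close>.\<close>

definition online_algorithm :: "nat \<Rightarrow> (real vec \<Rightarrow> real vec list \<Rightarrow> real vec) \<Rightarrow> bool" where
  "online_algorithm m A \<longleftrightarrow>
     (\<forall>w \<in> pos_vecs m. \<forall>cs. cs \<noteq> [] \<and> set cs \<subseteq> pos_vecs m \<longrightarrow> A w cs \<in> item_allocations m)"

definition online_alloc ::
    "(real vec \<Rightarrow> real vec list \<Rightarrow> real vec) \<Rightarrow> real vec \<Rightarrow> real mat \<Rightarrow> real mat" where
  "online_alloc A w P = mat (dim_row P) (dim_col P)
     (\<lambda>(i, j). A w (map (col P) [0..<Suc j]) $ i)"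

end

theory Submission imports Defs begin

text \<open>The prediction is the all-ones vector. The first item has the same weight \<open>m \<approx> \<tau>\<close> for all
  agents, so whatever the algorithm does, some agent \<open>r\<close> gets load at most 1 from it. The remaining
  items can be served well only to the agents other than \<open>r\<close>, each of which has a private item of
  weight \<open>\<tau>\<close>; so \<open>r\<close> is stuck with load \<open>O(1)\<close>. The vector with \<open>\<tau>\<close> at \<open>r\<close> and 1 elsewhere gives
  \<open>r\<close> a constant fraction of the first item.\<close>

text \<open>Averaging over the \<open>m\<close> shares, which sum to 1. The product form is exactly
  the load that an item of weight \<open>m\<close> gives to agent \<open>r\<close>.\<close>

lemma item_allocations_small_component:
  assumes "y \<in> item_allocations m" "m > 0"
  obtains r where "r < m" "real m * y $ r \<le> 1"
proof -
  have "\<exists>r<m. real m * y $ r \<le> 1"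
  proof (rule ccontr)
    assume "\<not> ?thesis"
    then have "(\<Sum>i<m. 1) < (\<Sum>i<m. real m * y $ i)"
      using \<open>m > 0\<close> by (intro sum_strict_mono) (auto simp: not_le)
    also have "\<dots> = real m"
      using assms(1) by (simp add: item_allocations_def flip: sum_distrib_left)
    finally show False by simp
  qed
  then show thesis using that by blast
qed

lemma maxmin_geI:
  assumes "dim_row P > 0" "\<And>i. i < dim_row P \<Longrightarrow> b \<le> load P x i"
  shows "b \<le> maxmin P x"
  using assms unfolding maxmin_def by (intro Min.boundedI) auto

lemma maxmin_le_load:
  assumes "r < dim_row P"
  shows "maxmin P x \<le> load P x r"
  using assms unfolding maxmin_def by (intro Min_le) auto

lemma load_ge_single:
  assumes "P \<in> instances m n" "i < m" "j < n" "\<And>k. k < n \<Longrightarrow> 0 \<le> x $$ (i, k)"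
  shows "P $$ (i, j) * x $$ (i, j) \<le> load P x i"
proof -
  have "0 \<le> P $$ (i, k) * x $$ (i, k)" if "k < n" for k
    using assms that by (auto simp: instances_def less_imp_le intro!: mult_nonneg_nonneg)
  then show ?thesis
    using assms unfolding load_def by (intro member_le_sum) (auto simp: instances_def)
qed

lemma prop_alloc_nonneg:
  assumes "P \<in> instances m n" "w \<in> pos_vecs m" "i < m" "j < n"
  shows "0 \<le> prop_alloc \<alpha> P w $$ (i, j)"
  using assms
  by (auto simp: prop_alloc_def instances_def pos_vecs_def less_imp_le
      intro!: divide_nonneg_nonneg sum_nonneg mult_nonneg_nonneg)

lemma online_alloc_item_allocation:
  assumes "online_algorithm m A" "w \<in> pos_vecs m" "P \<in> instances m n" "j < n"
  shows "A w (map (col P) [0..<Suc j]) \<in> item_allocations m"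
proof -
  have "set (map (col P) [0..<Suc j]) \<subseteq> pos_vecs m"
    using assms by (auto simp: instances_def pos_vecs_def)
  moreover have "map (col P) [0..<Suc j] \<noteq> []" by simp
  ultimately show ?thesis using assms(1,2) unfolding online_algorithm_def by blast
qed

text \<open>Column 0 is independent of \<open>r\<close>, so \<open>r\<close> may be chosen after the
  algorithm has allocated that item. Column \<open>Suc i\<close> is the private item of agent
  \<open>i\<close>; column \<open>Suc r\<close> is a dummy that keeps the number of items
  independent of \<open>r\<close>. The small \<epsilon> stands in for weight 0, as weights must be
  positive.\<close>

definition hard_instance :: "nat \<Rightarrow> real \<Rightarrow> real \<Rightarrow> nat \<Rightarrow> real mat" where
  "hard_instance m \<tau> \<epsilon> r = mat m (Suc m)
     (\<lambda>(i, j). if j = 0 then real m else if j = Suc i \<and> i \<noteq> r then \<tau> else \<epsilon>)"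

definition hard_param :: "nat \<Rightarrow> real \<Rightarrow> nat \<Rightarrow> real vec" where
  "hard_param m \<tau> r = vec m (\<lambda>i. if i = r then \<tau> else 1)"

lemma hard_instance_in_instances:
  "m > 0 \<Longrightarrow> \<tau> > 0 \<Longrightarrow> \<epsilon> > 0 \<Longrightarrow> hard_instance m \<tau> \<epsilon> r \<in> instances m (Suc m)"
  by (auto simp: hard_instance_def instances_def)

lemma hard_param_in_pos_vecs: "\<tau> > 0 \<Longrightarrow> hard_param m \<tau> r \<in> pos_vecs m"
  by (auto simp: hard_param_def pos_vecs_def)

text \<open>All ratios of the uniform vector are 1, and those of \<open>hard_param\<close> lie
  between 1/\<tau> and \<tau>. The bound is tight when \<open>r\<close> is in the
  denominator.\<close>

lemma approximate_wrt_hard_param: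
  assumes "\<tau> \<ge> 1"
  shows "approximate_wrt m \<tau> (vec m (\<lambda>_. 1)) (hard_param m \<tau> r)"
proof -
  have "1 \<le> \<tau> * \<tau>" using mult_mono[of 1 \<tau> 1 \<tau>] assms by simp
  then show ?thesis
    using assms by (auto simp: approximate_wrt_def hard_param_def)
qed

lemma sum_hard_param:
  assumes "r < m"
  shows "(\<Sum>i<m. hard_param m \<tau> r $ i) = \<tau> + (real m - 1)"
proof -
  have "(\<Sum>i<m. hard_param m \<tau> r $ i) = (\<Sum>i<m. (if i = r then \<tau> - 1 else 0) + 1)"
    by (intro sum.cong) (auto simp: hard_param_def)
  also have "\<dots> = \<tau> + (real m - 1)"
    using assms by (simp add: sum.distrib)
  finally show ?thesis .
qed

text \<open>Every agent gets at least half of one item of weight at least \<tau>: agent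
  \<open>r\<close> of the common item, since its parameter \<tau> is at least half of the total
  \<tau> + m - 1, and every other agent of its private item, where the competitors together
  contribute at most \<epsilon>^\<alpha> * 2\<tau> \<le> 1.\<close>

lemma maxmin_prop_alloc_hard_instance:
  assumes "\<tau> \<ge> 1" "\<alpha> > 0" "\<epsilon> > 0" "\<epsilon> powr \<alpha> \<le> 1 / (2 * \<tau>)" "\<tau> \<le> real m" "real m \<le> \<tau> + 1" "r < m"
  shows "\<tau> / 2 \<le> maxmin (hard_instance m \<tau> \<epsilon> r)
           (prop_alloc \<alpha> (hard_instance m \<tau> \<epsilon> r) (hard_param m \<tau> r))"
    (is "_ \<le> maxmin ?P (prop_alloc _ _ ?w)")
proof (rule maxmin_geI)
  let ?x = "prop_alloc \<alpha> ?P ?w"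
  have P: "?P \<in> instances m (Suc m)" using assms by (intro hard_instance_in_instances) auto
  have w: "?w \<in> pos_vecs m" using assms by (intro hard_param_in_pos_vecs) auto
  have dim [simp]: "dim_row ?P = m" "dim_col ?P = Suc m" by (simp_all add: hard_instance_def)
  have total_le: "(\<Sum>i<m. ?w $ i) \<le> 2 * \<tau>"
    using sum_hard_param[OF \<open>r < m\<close>, of \<tau>] assms by simp
  have total_pos: "0 < (\<Sum>i<m. ?w $ i)"
    using sum_hard_param[OF \<open>r < m\<close>, of \<tau>] assms by simp
  show "0 < dim_row ?P" using assms by simp
  fix i assume "i < dim_row ?P"
  then have i: "i < m" by simp
  have single: "?P $$ (i, j) * ?x $$ (i, j) \<le> load ?P ?x i" if "j < Suc m" for j
    using that P w i by (intro load_ge_single[OF P] prop_alloc_nonneg)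
  show "\<tau> / 2 \<le> load ?P ?x i"
  proof (cases "i = r")
    case True
    \<comment> \<open>All agents value item 0 equally, so the powers cancel and the shares are
      proportional to the parameters.\<close>
    have "?x $$ (i, 0) = (real m powr \<alpha> * \<tau>) / (real m powr \<alpha> * (\<Sum>i<m. ?w $ i))"
      using i True
      by (simp add: prop_alloc_def hard_instance_def sum_distrib_left)
         (simp add: hard_param_def)
    also have "\<dots> = \<tau> / (\<Sum>i<m. ?w $ i)" using i by simp
    also have "\<dots> \<ge> 1 / 2"
      using total_le total_pos by (simp add: field_simps)
    finally have "\<tau> * (1 / 2) \<le> ?P $$ (i, 0) * ?x $$ (i, 0)"
      using assms i by (intro mult_mono) (auto simp: hard_instance_def)
    also have "\<dots> \<le> load ?P ?x i" by (rule single) simp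
    finally show ?thesis by simp
  next
    case False
    define D where "D = (\<Sum>k<m. ?P $$ (k, Suc i) powr \<alpha> * ?w $ k)"
    \<comment> \<open>The \<epsilon>-term is also charged to \<open>k = i\<close>, so that the full
      parameter sum appears and \<open>total_le\<close> applies.\<close>
    have "D \<le> (\<Sum>k<m. (if k = i then \<tau> powr \<alpha> else 0) + \<epsilon> powr \<alpha> * ?w $ k)"
      unfolding D_def using False i assms
      by (intro sum_mono) (auto simp: hard_instance_def hard_param_def)
    also have "\<dots> = \<tau> powr \<alpha> + \<epsilon> powr \<alpha> * (\<Sum>k<m. ?w $ k)"
      using i by (simp add: sum.distrib sum_distrib_left)
    also have "\<epsilon> powr \<alpha> * (\<Sum>k<m. ?w $ k) \<le> 1 / (2 * \<tau>) * (2 * \<tau>)"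
      using assms total_le total_pos by (intro mult_mono) auto
    also have "\<dots> \<le> \<tau> powr \<alpha>"
      using assms by (simp add: ge_one_powr_ge_zero)
    finally have D: "D \<le> 2 * \<tau> powr \<alpha>" by simp
    have "D > 0" unfolding D_def using P w i
      by (intro sum_pos mult_pos_pos) (force simp: instances_def pos_vecs_def)+
    have "?x $$ (i, Suc i) = \<tau> powr \<alpha> / D"
      using i False by (simp add: prop_alloc_def D_def)
        (simp add: hard_instance_def hard_param_def)
    also have "\<dots> \<ge> 1 / 2" using D \<open>D > 0\<close> by (simp add: field_simps)
    finally have "\<tau> * (1 / 2) \<le> ?P $$ (i, Suc i) * ?x $$ (i, Suc i)"
      using assms i False by (intro mult_mono) (auto simp: hard_instance_def)
    also have "\<dots> \<le> load ?P ?x i" using i by (intro single) simp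
    finally show ?thesis by simp
  qed
qed

text \<open>Agent \<open>r\<close> gets load at most 1 from item 0 by assumption, and each of the
  \<open>m\<close> later items is worth only \<epsilon> to it, for at most m * \<epsilon> \<le> 1
  more.\<close>

lemma maxmin_online_alloc_hard_instance:
  assumes "online_algorithm m A" "w \<in> pos_vecs m" "\<tau> > 0" "\<epsilon> > 0" "real m * \<epsilon> \<le> 1" "r < m"
    and "real m * A w [vec m (\<lambda>_. real m)] $ r \<le> 1"
  shows "maxmin (hard_instance m \<tau> \<epsilon> r) (online_alloc A w (hard_instance m \<tau> \<epsilon> r)) \<le> 2"
    (is "maxmin ?P ?x \<le> 2")
proof -
  have P: "?P \<in> instances m (Suc m)" using assms by (intro hard_instance_in_instances) auto
  have dim [simp]: "dim_row ?P = m" "dim_col ?P = Suc m" by (simp_all add: hard_instance_def)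
  \<comment> \<open>When item 0 is allocated, the algorithm has seen only this column, so its answer
    is the one that the assumption on \<open>r\<close> speaks of.\<close>
  have col0: "col ?P 0 = vec m (\<lambda>_. real m)"
    by (auto simp: hard_instance_def)
  have le1: "?x $$ (r, j) \<le> 1" if "j < Suc m" for j
    using online_alloc_item_allocation[OF assms(1,2) P that] that \<open>r < m\<close>
    by (auto simp: online_alloc_def item_allocations_def simp del: upt_Suc)
  have "maxmin ?P ?x \<le> load ?P ?x r" using assms by (intro maxmin_le_load) simp
  also have "load ?P ?x r
      = ?P $$ (r, 0) * ?x $$ (r, 0) + (\<Sum>j<m. ?P $$ (r, Suc j) * ?x $$ (r, Suc j))"
    by (simp add: load_def sum.lessThan_Suc_shift del: sum.lessThan_Suc)
  also have "?P $$ (r, 0) * ?x $$ (r, 0) = real m * A w [vec m (\<lambda>_. real m)] $ r"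
    using \<open>r < m\<close> by (simp add: online_alloc_def col0) (simp add: hard_instance_def)
  also have "\<dots> \<le> 1" by fact
  also have "(\<Sum>j<m. ?P $$ (r, Suc j) * ?x $$ (r, Suc j)) \<le> (\<Sum>j<m. \<epsilon> * 1)"
  proof (intro sum_mono)
    fix j assume "j \<in> {..<m}"
    then have "?P $$ (r, Suc j) = \<epsilon>" "?x $$ (r, Suc j) \<le> 1"
      using \<open>r < m\<close> le1[of "Suc j"] by (auto simp: hard_instance_def)
    then show "?P $$ (r, Suc j) * ?x $$ (r, Suc j) \<le> \<epsilon> * 1"
      using \<open>\<epsilon> > 0\<close> by simp
  qed
  also have "\<dots> \<le> 1" using assms by simp
  finally show ?thesis by simp
qed

theorem lemma5p5:
  fixes \<alpha> :: real
  assumes "\<alpha> > 0"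
  shows "\<exists>c::real. \<exists>C::real. c > 0 \<and> C > 0 \<and>
    (\<forall>\<tau>::real. \<tau> \<ge> 1 \<longrightarrow>
      (\<exists>m n w. m > 0 \<and> n > 0 \<and> w \<in> pos_vecs m \<and>
        (\<forall>A. online_algorithm m A \<longrightarrow>
          (\<exists>P \<in> instances m n. \<exists>w' \<in> pos_vecs m.
             approximate_wrt m \<tau> w w' \<and>
             c * \<tau> \<le> maxmin P (prop_alloc \<alpha> P w') \<and>
             maxmin P (online_alloc A w P) \<le> C))))"
proof (intro exI conjI allI impI)
  show "(1 / 2 :: real) > 0" "(2 :: real) > 0" by simp_all
  fix \<tau> :: real assume \<tau>: "\<tau> \<ge> 1"
  \<comment> \<open>The common item must weigh at least \<tau>, while \<open>m\<close> \<le> \<tau>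
    + 1 keeps the parameter sum below 2\<tau>.\<close>
  define m where "m = nat \<lceil>\<tau>\<rceil>"
  have m: "m > 0" "\<tau> \<le> real m" "real m \<le> \<tau> + 1"
    using \<tau> unfolding m_def by linarith+
  define \<delta> where "\<delta> = 1 / (2 * \<tau>)"
  \<comment> \<open>The bound \<delta> gives m * \<epsilon> \<le> 1, because m \<le> 2\<tau>; the
    other bound gives \<epsilon>^\<alpha> \<le> \<delta>, for any positive \<alpha>.\<close>
  define \<epsilon> where "\<epsilon> = min \<delta> (\<delta> powr (1 / \<alpha>))"
  have "\<delta> > 0" using \<tau> by (simp add: \<delta>_def)
  then have \<epsilon>: "\<epsilon> > 0" by (simp add: \<epsilon>_def)
  have "\<epsilon> powr \<alpha> \<le> (\<delta> powr (1 / \<alpha>)) powr \<alpha>"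
    using \<epsilon> assms by (intro powr_mono2) (auto simp: \<epsilon>_def)
  also have "\<dots> = \<delta>" using assms \<open>\<delta> > 0\<close> by (simp add: powr_powr)
  finally have \<epsilon>_powr: "\<epsilon> powr \<alpha> \<le> 1 / (2 * \<tau>)" by (simp add: \<delta>_def)
  have "real m * \<epsilon> \<le> (2 * \<tau>) * \<delta>"
    using m \<tau> \<epsilon> by (intro mult_mono) (auto simp: \<epsilon>_def)
  also have "\<dots> = 1" using \<tau> by (simp add: \<delta>_def)
  finally have m\<epsilon>: "real m * \<epsilon> \<le> 1" .
  define w :: "real vec" where "w = vec m (\<lambda>_. 1)"
  show "m > 0" "Suc m > 0" by (simp_all add: m)
  show w: "w \<in> pos_vecs m" by (simp add: w_def pos_vecs_def)
  fix A assume A: "online_algorithm m A"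
  have "vec m (\<lambda>_. real m) \<in> pos_vecs m" using m by (simp add: pos_vecs_def)
  then have "A w [vec m (\<lambda>_. real m)] \<in> item_allocations m"
    using A w unfolding online_algorithm_def by auto
  \<comment> \<open>The adversary reacts to \<open>A\<close> only here: \<open>m\<close> and
    \<open>w\<close> are already fixed, and just the instance and the true parameters depend on
    \<open>r\<close>.\<close>
  then obtain r where r: "r < m" "real m * A w [vec m (\<lambda>_. real m)] $ r \<le> 1"
    using item_allocations_small_component \<open>m > 0\<close> by blast
  show "\<exists>P \<in> instances m (Suc m). \<exists>w' \<in> pos_vecs m. approximate_wrt m \<tau> w w' \<and>
          1 / 2 * \<tau> \<le> maxmin P (prop_alloc \<alpha> P w') \<and> maxmin P (online_alloc A w P) \<le> 2"
  proof (intro bexI conjI)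
    show "approximate_wrt m \<tau> w (hard_param m \<tau> r)"
      unfolding w_def using \<tau> by (rule approximate_wrt_hard_param)
    show "1 / 2 * \<tau> \<le> maxmin (hard_instance m \<tau> \<epsilon> r)
        (prop_alloc \<alpha> (hard_instance m \<tau> \<epsilon> r) (hard_param m \<tau> r))"
      using maxmin_prop_alloc_hard_instance[OF \<tau> assms \<epsilon> \<epsilon>_powr m(2,3) r(1)] by simp
    show "maxmin (hard_instance m \<tau> \<epsilon> r) (online_alloc A w (hard_instance m \<tau> \<epsilon> r)) \<le> 2"
      using \<tau> by (intro maxmin_online_alloc_hard_instance[OF A w _ \<epsilon> m\<epsilon> r]) simp
  qed (use m \<tau> \<epsilon> in \<open>auto intro: hard_instance_in_instances hard_param_in_pos_vecs\<close>)
qed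

end
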